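(* Let $G$ be an abelian group and let $(A,B,C)$ be a trio in $G$. Then $\delta(A,B,C)\le|\pi(A+B+C)|$.
   Context: For a subset $S$ of an abelian group $G$, the period of $S$ is the subgroup $\pi(S)=\{g\in G: S+g=S\}$. Sumsets are $A+B+C=\{a+b+c: a\in A,\ b\in B,\ c\in C\}$. A set $S\subseteq G$ is co-finite if $G\setminus S$ is finite. A trio in $G$ is a triple $(A,B,C)$ of non-empty subsets of $G$ such that $A+B+C\ne G$ and each of $A,B,C$ is either finite or co-finite in $G$. (If $G$ is infinite, then at most one component of a trio is infinite. The period of the sumset $A+B+C$ of a trio is always finite.) The deficiency $\delta(A,B,C)$ of a trio is defined as follows. If $A,B,C$ are all finite while $G$ is infinite, then $\delta(A,B,C)=-\infty$. Otherwise, rename the three sets so that $A$ is co-finite while $B$ and $C$ are finite, and put $\delta(A,B,C)=-|G\setminus A|+|B|+|C|$. If $G$ is finite, this equals $|A|+|B|+|C|-|G|$ and does not depend on the renaming. *)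

theory Defs
  imports "HOL-Library.Set_Algebras" "HOL-Library.Extended"
begin

definition period :: "'a::ab_group_add set \<Rightarrow> 'a set" where
  "period S = {g. (\<lambda>s. s + g) ` S = S}"

definition cofinite_set :: "'a set \<Rightarrow> bool" where
  "cofinite_set S \<longleftrightarrow> finite (UNIV - S)"

definition trio :: "'a::ab_group_add set \<Rightarrow> 'a set \<Rightarrow> 'a set \<Rightarrow> bool" where
  "trio A B C \<longleftrightarrow>
     A \<noteq> {} \<and> B \<noteq> {} \<and> C \<noteq> {} \<and> A + B + C \<noteq> UNIV \<and>
     (finite A \<or> cofinite_set A) \<and> (finite B \<or> cofinite_set B) \<and> (finite C \<or> cofinite_set C)"

definition deficiency_first :: "'a set \<Rightarrow> 'a set \<Rightarrow> 'a set \<Rightarrow> int" where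
  "deficiency_first A B C = - int (card (UNIV - A)) + int (card B) + int (card C)"

(* The set playing the role of the co-finite component is the first one that can
   be renamed to A.  For a trio some branch condition always applies and the choice is
   immaterial, see deficiency_cases, deficiency_permute and deficiency_finite_group below;
   the last branch only makes the function total on other triples. *)
definition deficiency :: "'a::ab_group_add set \<Rightarrow> 'a set \<Rightarrow> 'a set \<Rightarrow> int extended" where
  "deficiency A B C =
    (if infinite (UNIV :: 'a set) \<and> finite A \<and> finite B \<and> finite C then Minf
     else if cofinite_set A \<and> finite B \<and> finite C then Fin (deficiency_first A B C)
     else if cofinite_set B \<and> finite A \<and> finite C then Fin (deficiency_first B A C)
     else if cofinite_set C \<and> finite A \<and> finite B then Fin (deficiency_first C A B)
     else Minf)"

lemma period_subgroup:
  shows "0 \<in> period S"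
    and "g \<in> period S \<Longrightarrow> h \<in> period S \<Longrightarrow> g + h \<in> period S"
    and "g \<in> period S \<Longrightarrow> - g \<in> period S"
proof -
  show "0 \<in> period S" by (simp add: period_def)
next
  assume g: "g \<in> period S" and h: "h \<in> period S"
  have "(\<lambda>s. s + (g + h)) ` S = (\<lambda>s. s + h) ` ((\<lambda>s. s + g) ` S)"
    by (simp add: image_image add.assoc)
  with g h show "g + h \<in> period S" by (simp add: period_def)
next
  assume "g \<in> period S"
  then have "(\<lambda>s. s + - g) ` S = (\<lambda>s. s + - g) ` ((\<lambda>s. s + g) ` S)" by (simp add: period_def)
  also have "\<dots> = S" by (simp add: image_image)
  finally show "- g \<in> period S" by (simp add: period_def)
qed

lemma period_compl: "period (- S) = period S"
proof -
  have "(\<lambda>s. s + g) ` (- S) = - ((\<lambda>s. s + g) ` S)" for g :: 'a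
    by (rule bij_image_Compl_eq) (rule bij_betw_byWitness[where f' = "\<lambda>x. x - g"], auto)
  then show ?thesis by (auto simp: period_def)
qed

lemma finite_period:
  assumes "finite S" "S \<noteq> {}"
  shows "finite (period S)"
proof -
  obtain s where s: "s \<in> S" using assms(2) by blast
  have "g \<in> (\<lambda>t. t - s) ` S" if "g \<in> period S" for g
  proof
    show "s + g \<in> S" using that s by (auto simp: period_def)
  qed simp
  then have "period S \<subseteq> (\<lambda>t. t - s) ` S" by blast
  with assms(1) show ?thesis by (simp add: finite_subset)
qed

lemma sumset_commute3:
  fixes A B C :: "'a::ab_group_add set"
  shows "B + A + C = A + B + C" "A + C + B = A + B + C"
  by (simp_all add: add.commute add.left_commute add.assoc)

lemma cofinite_sumset:
  assumes "cofinite_set (A :: 'a::ab_group_add set)" "b \<in> B"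
  shows "cofinite_set (A + B)"
proof -
  have "UNIV - (A + B) \<subseteq> (\<lambda>x. x + b) ` (UNIV - A)"
  proof
    fix x assume "x \<in> UNIV - (A + B)"
    then have "x - b \<in> UNIV - A"
      using assms(2) set_plus_intro[of "x - b" A b B] by auto
    then show "x \<in> (\<lambda>x. x + b) ` (UNIV - A)"
      by (rule rev_image_eqI) simp
  qed
  with assms(1) show ?thesis
    unfolding cofinite_set_def by (meson finite_imageI finite_subset)
qed

lemma infinite_components_sum:
  assumes "cofinite_set (A :: 'a::ab_group_add set)" "infinite B"
  shows "A + B = UNIV"
proof -
  have "x \<in> A + B" for x
  proof -
    have "infinite ((\<lambda>b. x - b) ` B)"
      using assms(2) by (simp add: finite_image_iff inj_on_def)
    then have "\<not> (\<lambda>b. x - b) ` B \<subseteq> UNIV - A"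
      using assms(1) finite_subset unfolding cofinite_set_def by blast
    then obtain b where "b \<in> B" "x - b \<in> A" by blast
    then show ?thesis using set_plus_intro[of "x - b" A b B] by simp
  qed
  then show ?thesis by blast
qed

lemma UNIV_plus:
  assumes "C \<noteq> {}"
  shows "(UNIV :: 'a::ab_group_add set) + C = UNIV"
proof -
  obtain c where c: "c \<in> C" using assms by blast
  have "x \<in> UNIV + C" for x using set_plus_intro[OF UNIV_I[of "x - c"] c] by simp
  then show ?thesis by blast
qed

lemma trio_permute:
  assumes "trio A B C"
  shows "trio B A C" "trio A C B"
  using assms sumset_commute3(1)[of B A C] sumset_commute3(2)[of A C B]
  unfolding trio_def by simp_all

lemma trio_two_finite:
  assumes "trio A B C"
  shows "finite A \<or> finite B"
proof (rule ccontr)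
  assume "\<not> (finite A \<or> finite B)"
  then have "cofinite_set A" "infinite B" using assms unfolding trio_def by blast+
  then have "A + B = UNIV" by (rule infinite_components_sum)
  then show False using assms UNIV_plus[of C] unfolding trio_def by simp
qed

lemma finite_period_trio:
  assumes "trio A B C"
  shows "finite (period (A + B + C))"
proof -
  have *: "finite (period (A + B + C))" if t: "trio A B C" and A: "cofinite_set A" for A B C :: "'a set"
  proof -
    from t obtain b c where "b \<in> B" "c \<in> C" unfolding trio_def by blast
    then have "cofinite_set (A + B + C)" using A by (meson cofinite_sumset)
    then have "finite (period (- (A + B + C)))"
      using t by (intro finite_period) (auto simp: cofinite_set_def trio_def Compl_eq_Diff_UNIV)
    then show ?thesis by (simp add: period_compl)
  qed
  consider "cofinite_set A" | "cofinite_set B" | "cofinite_set C"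
    | "finite A" "finite B" "finite C"
    using assms unfolding trio_def by blast
  then show ?thesis
  proof cases
    case 1 then show ?thesis using *[OF assms] by simp
  next
    case 2 then show ?thesis using *[of B A C] trio_permute(1)[OF assms] sumset_commute3(1)[of B A C] by simp
  next
    case 3 then show ?thesis
      using *[of C A B] trio_permute(1)[OF trio_permute(2)[OF assms]]
        sumset_commute3(1)[of C A B] sumset_commute3(2)[of A C B] by simp
  next
    case 4
    obtain a b c where "a \<in> A" "b \<in> B" "c \<in> C" using assms unfolding trio_def by blast
    then have "a + b + c \<in> A + B + C" by (intro set_plus_intro)
    then have "A + B + C \<noteq> {}" by blast
    with 4 show ?thesis by (intro finite_period) (auto intro: finite_set_plus)
  qed
qed

lemma deficiency_finite_group:
  fixes A B C :: "'a::ab_group_add set"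
  assumes "finite (UNIV :: 'a set)"
  shows "deficiency A B C =
    Fin (int (card A) + int (card B) + int (card C) - int (card (UNIV :: 'a set)))"
proof -
  have fin: "finite S" for S :: "'a set" using assms by (rule rev_finite_subset) simp
  have "card A \<le> card (UNIV :: 'a set)" using assms by (simp add: card_mono)
  with assms fin show ?thesis
    by (simp add: deficiency_def deficiency_first_def cofinite_set_def card_Diff_subset of_nat_diff)
qed

lemma infinite_cofinite_set:
  "infinite (UNIV :: 'a set) \<Longrightarrow> cofinite_set (S :: 'a set) \<Longrightarrow> infinite S"
  unfolding cofinite_set_def by (metis Diff_infinite_finite)

lemma deficiency_permute:
  fixes A B C :: "'a::ab_group_add set"
  shows "deficiency B A C = deficiency A B C" "deficiency A C B = deficiency A B C"
proof -
  show "deficiency B A C = deficiency A B C"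
  proof (cases "finite (UNIV :: 'a set)")
    case True then show ?thesis by (simp add: deficiency_finite_group)
  next
    case False
    then have "cofinite_set S \<Longrightarrow> infinite S" for S :: "'a set"
      by (rule infinite_cofinite_set)
    with False show ?thesis
      by (cases "finite A"; cases "finite B"; cases "finite C";
          simp add: deficiency_def deficiency_first_def; blast?)
  qed
  show "deficiency A C B = deficiency A B C"
  proof (cases "finite (UNIV :: 'a set)")
    case True then show ?thesis by (simp add: deficiency_finite_group)
  next
    case False
    then have "cofinite_set S \<Longrightarrow> infinite S" for S :: "'a set"
      by (rule infinite_cofinite_set)
    with False show ?thesis
      by (cases "finite A"; cases "finite B"; cases "finite C";
          simp add: deficiency_def deficiency_first_def; blast?)
  qed
qed

lemma deficiency_cases:
  fixes A B C :: "'a::ab_group_add set"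
  assumes "trio A B C"
  obtains (all_finite) "infinite (UNIV :: 'a set)" "finite A" "finite B" "finite C"
      "deficiency A B C = Minf"
    | (first) "cofinite_set A" "finite B" "finite C"
      "deficiency A B C = Fin (deficiency_first A B C)"
    | (second) "cofinite_set B" "finite A" "finite C"
      "deficiency A B C = Fin (deficiency_first B A C)"
    | (third) "cofinite_set C" "finite A" "finite B"
      "deficiency A B C = Fin (deficiency_first C A B)"
proof -
  have two: "finite A \<or> finite B" "finite A \<or> finite C" "finite B \<or> finite C"
    using trio_two_finite[OF assms] trio_two_finite[OF trio_permute(2)[OF assms]]
      trio_two_finite[OF trio_permute(2)[OF trio_permute(1)[OF assms]]] by blast+
  have cof: "cofinite_set A" if "finite (UNIV :: 'a set)"
    using that by (simp add: cofinite_set_def)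
  have each: "finite A \<or> cofinite_set A" "finite B \<or> cofinite_set B" "finite C \<or> cofinite_set C"
    using assms unfolding trio_def by blast+
  consider "infinite (UNIV :: 'a set)" "finite A" "finite B" "finite C"
    | "cofinite_set A" "finite B" "finite C"
    | "\<not> (cofinite_set A \<and> finite B \<and> finite C)" "cofinite_set B" "infinite B" "finite A" "finite C"
    | "\<not> (cofinite_set A \<and> finite B \<and> finite C)" "cofinite_set C" "infinite C" "finite A" "finite B"
    using two cof each by blast
  then show thesis
  proof cases
    case 1 then show ?thesis by (intro all_finite) (simp_all add: deficiency_def)
  next
    case 2
    then show ?thesis
    proof (cases "infinite (UNIV :: 'a set) \<and> finite A")
      case True then show ?thesis using 2 infinite_cofinite_set by blast
    next
      case False then show ?thesis using 2 by (intro first) (auto simp: deficiency_def)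
    qed
  next
    case 3 then show ?thesis by (intro second) (auto simp: deficiency_def)
  next
    case 4 then show ?thesis by (intro third) (auto simp: deficiency_def)
  qed
qed

end

theory Submission
  imports Defs
begin

text \<open>
  The inequality is a form of Kneser's addition theorem.  Call the number \<open>|S| + |\<pi>(S)|\<close> the
  weight of a finite non-empty set \<open>S\<close>.  Two facts carry the proof.

  First, the weight of a union is at least the smaller of the two weights
  (\<open>weight_union\<close>): unless one set contains the other, \<open>C \<union> D\<close> exceeds \<open>C\<close> by at least
  \<open>|\<pi>(C)| - |\<pi>(C) \<inter> \<pi>(D)|\<close> elements, or else exceeds \<open>D\<close> by at least
  \<open>|\<pi>(D)| - |\<pi>(C) \<inter> \<pi>(D)|\<close> elements, while \<open>\<pi>(C) \<inter> \<pi>(D)\<close> still fixes the union.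

  Second, each element of \<open>B + C\<close> lies in some subset of \<open>B + C\<close> of weight at least
  \<open>|B| + |C|\<close> (\<open>heavy_subset_of_sumset\<close>).  It is found by applying Dyson's transform, which
  keeps \<open>|B| + |C|\<close> and does not enlarge \<open>B + C\<close>, until it stops changing the pair.

  Thus \<open>B + C\<close>, and more generally every union of translates of \<open>B + C\<close>, has weight at least
  \<open>|B| + |C|\<close>.  For a trio with \<open>A\<close> co-finite, let \<open>D\<close> be the complement of \<open>A + B + C\<close> and
  consider \<open>X = D - B - C\<close>, a union of translates of \<open>-(B + C)\<close>.  It is disjoint from \<open>A\<close>.
  Moreover \<open>\<pi>(X) \<subseteq> \<pi>(D) = \<pi>(A + B + C)\<close>: a translation that moved some \<open>d \<in> D\<close> to
  \<open>a + b + c\<close> would move the point \<open>d - b - c\<close> of \<open>X\<close> to \<open>a\<close>, outside \<open>X\<close>.  Hence \<open>|B| + |C| \<le> |X| + |\<pi>(X)| \<le> |G - A| + |\<pi>(A + B + C)|\<close>.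
\<close>

section \<open>Periods and cosets\<close>

lemma period_add_iff:
  assumes "g \<in> period S"
  shows "x + g \<in> S \<longleftrightarrow> x \<in> S"
proof
  assume "x + g \<in> S"
  then have "x + g \<in> (\<lambda>s. s + g) ` S" using assms by (simp add: period_def)
  then show "x \<in> S" by auto
next
  assume "x \<in> S"
  then have "x + g \<in> (\<lambda>s. s + g) ` S" by blast
  then show "x + g \<in> S" using assms by (simp add: period_def)
qed

lemma period_diff:
  assumes "g \<in> period S" "h \<in> period S"
  shows "g - h \<in> period S"
  using period_subgroup(2)[OF assms(1) period_subgroup(3)[OF assms(2)]] by simp

text \<open>A translation is injective, so one that maps a finite set into itself permutes it.\<close>

lemma period_finiteI:
  assumes "finite S" "\<And>x. x \<in> S \<Longrightarrow> x + g \<in> S"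
  shows "g \<in> period S"
  unfolding period_def using endo_inj_surj[OF assms(1), of "\<lambda>s. s + g"] assms(2) by auto

lemma period_Int_subset_period_Un: "period C \<inter> period D \<subseteq> period (C \<union> D)"
  by (auto simp: period_def image_Un)

lemma period_translate: "period ((+) d ` S) = period S"
proof -
  have "(\<lambda>s. s + g) ` (+) d ` S = (+) d ` ((\<lambda>s. s + g) ` S)" for g
    by (simp add: image_image add.assoc)
  then show ?thesis by (simp add: period_def inj_image_eq_iff)
qed

lemma card_translate: "card ((+) (x :: 'a::ab_group_add) ` H) = card H"
  by (simp add: card_image)

text \<open>A translation by a period of \<open>S\<close> carries the trace of \<open>S\<close> on a coset to its trace on the
  translated coset; the further shift by \<open>h \<in> H\<close> leaves a coset of \<open>H\<close> where it is.\<close>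

lemma card_Int_coset_cong:
  assumes "g \<in> period S" "h \<in> H" "\<And>k. k \<in> H \<Longrightarrow> k + h \<in> H" "\<And>k. k \<in> H \<Longrightarrow> k - h \<in> H"
  shows "card (S \<inter> (+) (x + g + h) ` H) = card (S \<inter> (+) x ` H)"
proof -
  have "S \<inter> (+) (x + g + h) ` H = (\<lambda>s. s + g) ` (S \<inter> (+) x ` H)"
  proof (intro subset_antisym subsetI)
    fix z assume "z \<in> S \<inter> (+) (x + g + h) ` H"
    then obtain k where k: "k \<in> H" "z = x + g + h + k" "z \<in> S" by blast
    have "z - g \<in> S" using k(3) period_add_iff[OF assms(1), of "z - g"] by simp
    moreover have "z - g = x + (k + h)" using k(2) by (simp add: algebra_simps)
    ultimately have "z - g \<in> S \<inter> (+) x ` H" using assms(3)[OF k(1)] by auto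
    then show "z \<in> (\<lambda>s. s + g) ` (S \<inter> (+) x ` H)" by (rule rev_image_eqI) simp
  next
    fix z assume "z \<in> (\<lambda>s. s + g) ` (S \<inter> (+) x ` H)"
    then obtain k where k: "k \<in> H" "z = x + k + g" "x + k \<in> S" by auto
    have "z = (x + g + h) + (k - h)" using k(2) by (simp add: algebra_simps)
    moreover have "z \<in> S" using k(2,3) period_add_iff[OF assms(1)] by simp
    ultimately show "z \<in> S \<inter> (+) (x + g + h) ` H" using assms(4)[OF k(1)] by blast
  qed
  then show ?thesis by (simp add: card_image)
qed

section \<open>The weight of a union\<close>

text \<open>Write \<open>H = \<pi>(C)\<close> and \<open>K = \<pi>(D)\<close>.  Since \<open>x\<close> lies in \<open>C\<close> and not in \<open>D\<close>, the coset
  \<open>x + H\<close> is inside \<open>C\<close> and the coset \<open>x + K\<close> misses \<open>D\<close>.  Hence both counted sets lie in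
  \<open>C - D\<close>, and they overlap only in \<open>x + (H \<inter> K)\<close>.\<close>

lemma card_cross_le:
  fixes C D :: "'a::ab_group_add set"
  assumes "finite C" "finite D" "x \<in> C - D"
    and fin: "finite (period C \<inter> period D)"
  shows "card (C \<inter> (+) x ` period D) + card ((+) x ` period C - D)
    \<le> card (C - D) + card (period C \<inter> period D)"
proof -
  let ?U = "C \<inter> (+) x ` period D" and ?V = "(+) x ` period C - D"
  have U: "?U \<subseteq> C - D" and V: "?V \<subseteq> C - D"
    using assms(3) period_add_iff[of _ D x] period_add_iff[of _ C x] by auto
  have "finite ?U" "finite ?V" using U V assms(1) by (meson finite_Diff finite_subset)+
  then have "card ?U + card ?V = card (?U \<union> ?V) + card (?U \<inter> ?V)"
    by (rule card_Un_Int)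
  moreover have "card (?U \<union> ?V) \<le> card (C - D)"
    using U V assms(1) by (intro card_mono) auto
  moreover have "?U \<inter> ?V \<subseteq> (+) x ` (period C \<inter> period D)" by auto
  then have "card (?U \<inter> ?V) \<le> card (period C \<inter> period D)"
    using fin by (metis card_translate card_mono finite_imageI)
  ultimately show ?thesis by linarith
qed

text \<open>One of the cosets \<open>x + \<pi>(C)\<close> and \<open>x + \<pi>(D)\<close> lies wholly in \<open>C - D\<close>.  The first one
  does when \<open>D\<close> misses it.  Otherwise \<open>D\<close> contains
  a point \<open>y\<close> of \<open>x + \<pi>(C)\<close>, hence \<open>y + \<pi>(D)\<close>, which then lies in \<open>C\<close>; moving back by a
  period of \<open>C\<close> shows that \<open>x + \<pi>(D)\<close> lies in \<open>C\<close>, and this coset misses \<open>D\<close>.\<close>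

lemma coset_in_difference:
  fixes C D :: "'a::ab_group_add set"
  assumes "finite C" "x \<in> C - D"
    and none: "\<And>g h. g \<in> period C \<Longrightarrow> h \<in> period D \<Longrightarrow> x + g + h \<notin> D - C"
  shows "card (period C) \<le> card (C - D) \<or> card (period D) \<le> card (C - D)"
proof (cases "(+) x ` period C \<inter> D = {}")
  case True
  then have "(+) x ` period C \<subseteq> C - D" using assms(2) period_add_iff[of _ C x] by auto
  then have "card ((+) x ` period C) \<le> card (C - D)" using assms(1) by (simp add: card_mono)
  then show ?thesis by (simp add: card_translate)
next
  case False
  then obtain g where g: "g \<in> period C" "x + g \<in> D" by blast
  have "x + h \<in> C - D" if h: "h \<in> period D" for h
  proof -
    have "x + g + h \<in> D" using g(2) period_add_iff[OF h] by simp
    then have "(x + h) + g \<in> C" using none[OF g(1) h] by (simp add: ac_simps)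
    then have "x + h \<in> C" using period_add_iff[OF g(1)] by simp
    moreover have "x + h \<notin> D" using assms(2) period_add_iff[OF h] by simp
    ultimately show ?thesis by simp
  qed
  then have "(+) x ` period D \<subseteq> C - D" by auto
  then have "card ((+) x ` period D) \<le> card (C - D)" using assms(1) by (simp add: card_mono)
  then show ?thesis by (simp add: card_translate)
qed

text \<open>The union must exceed one of two incomparable sets by nearly the size of that set's period.
  If some \<open>x \<in> C - D\<close> and \<open>y \<in> D - C\<close> differ by an element of \<open>\<pi>(C) + \<pi>(D)\<close>, then \<open>C\<close>
  has equally large traces on \<open>x + \<pi>(D)\<close> and \<open>y + \<pi>(D)\<close>, and similarly for \<open>D\<close>.  So the two
  estimates for \<open>x\<close> and \<open>y\<close> add up to complete cosets, and one of the alternatives holds by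
  averaging.\<close>

lemma union_excess:
  fixes C D :: "'a::ab_group_add set"
  assumes fC: "finite C" and fD: "finite D" and "\<not> C \<subseteq> D" "\<not> D \<subseteq> C"
  shows "card (period C) \<le> card (D - C) + card (period C \<inter> period D) \<or>
    card (period D) \<le> card (C - D) + card (period C \<inter> period D)"
proof (cases "\<exists>x g h. x \<in> C - D \<and> g \<in> period C \<and> h \<in> period D \<and> x + g + h \<in> D - C")
  case True
  then obtain x g h where x: "x \<in> C - D" and g: "g \<in> period C" and h: "h \<in> period D"
    and y: "x + g + h \<in> D - C" by blast
  let ?y = "x + g + h"
  have finC: "finite (period C)" and finD: "finite (period D)"
    using finite_period[OF fC] finite_period[OF fD] x y by auto
  have eqC: "card (C \<inter> (+) ?y ` period D) = card (C \<inter> (+) x ` period D)"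
    using g h by (intro card_Int_coset_cong) (auto intro: period_subgroup(2) period_diff)
  have "card (D \<inter> (+) (x + h + g) ` period C) = card (D \<inter> (+) x ` period C)"
    using g h by (intro card_Int_coset_cong) (auto intro: period_subgroup(2) period_diff)
  then have eqD: "card (D \<inter> (+) ?y ` period C) = card (D \<inter> (+) x ` period C)"
    by (simp add: ac_simps)
  have compl: "card (S - T) + card (T \<inter> S) = card S" if "finite S" for S T :: "'a set"
    using card_Int_Diff[OF that, of T] by (simp add: Int_commute)
  have "card ((+) ?y ` period D - C) + card (C \<inter> (+) ?y ` period D) = card (period D)"
    using compl[of "(+) ?y ` period D" C] finD by (simp add: card_translate)
  moreover have "card ((+) x ` period C - D) + card (D \<inter> (+) x ` period C) = card (period C)"
    using compl[of "(+) x ` period C" D] finC by (simp add: card_translate)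
  moreover have "card (C \<inter> (+) x ` period D) + card ((+) x ` period C - D)
      \<le> card (C - D) + card (period C \<inter> period D)"
    using x fC fD finC by (intro card_cross_le) auto
  moreover have "card (D \<inter> (+) ?y ` period C) + card ((+) ?y ` period D - C)
      \<le> card (D - C) + card (period D \<inter> period C)"
    using y fC fD finC by (intro card_cross_le) auto
  moreover have "card (period D \<inter> period C) = card (period C \<inter> period D)"
    by (simp add: Int_commute)
  ultimately show ?thesis using eqC eqD by linarith
next
  case False
  obtain x y where x: "x \<in> C - D" and y: "y \<in> D - C" using assms(3,4) by blast
  have "card (period C) \<le> card (C - D) \<or> card (period D) \<le> card (C - D)"
    using False x by (intro coset_in_difference[OF fC x]) blast
  moreover have "card (period D) \<le> card (D - C) \<or> card (period C) \<le> card (D - C)"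
  proof (rule coset_in_difference[OF fD y])
    fix h g assume hg: "h \<in> period D" "g \<in> period C"
    have "y + h + g + - g + - h = y" by simp
    with False y period_subgroup(3)[OF hg(1)] period_subgroup(3)[OF hg(2)]
    show "y + h + g \<notin> C - D" by metis
  qed
  ultimately show ?thesis by linarith
qed

lemma weight_union:
  fixes C D :: "'a::ab_group_add set"
  assumes fin: "finite C" "finite D" and ne: "C \<noteq> {}"
    and N: "N \<le> card C + card (period C)" "N \<le> card D + card (period D)"
  shows "N \<le> card (C \<union> D) + card (period (C \<union> D))"
proof -
  consider "C \<subseteq> D" | "D \<subseteq> C" | "\<not> C \<subseteq> D" "\<not> D \<subseteq> C" by blast
  then show ?thesis
  proof cases
    case 3
    have "finite (period (C \<union> D))" using fin ne by (intro finite_period) auto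
    then have "card (period C \<inter> period D) \<le> card (period (C \<union> D))"
      by (intro card_mono period_Int_subset_period_Un)
    moreover have "card (C \<union> D) = card C + card (D - C)"
      using fin card_Un_disjoint[of C "D - C"] by simp
    moreover have "card (C \<union> D) = card D + card (C - D)"
      using fin card_Un_disjoint[of D "C - D"] by (simp add: Un_commute)
    ultimately show ?thesis using union_excess[OF fin 3] N by linarith
  qed (use N in \<open>simp_all add: Un_absorb1 Un_absorb2\<close>)
qed

lemma weight_UNION:
  fixes f :: "'b \<Rightarrow> 'a::ab_group_add set"
  assumes "finite I" "I \<noteq> {}"
    and "\<And>i. i \<in> I \<Longrightarrow> finite (f i) \<and> f i \<noteq> {} \<and> N \<le> card (f i) + card (period (f i))"
  shows "N \<le> card (\<Union>i\<in>I. f i) + card (period (\<Union>i\<in>I. f i))"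
  using assms
proof (induction I rule: finite_ne_induct)
  case (insert i I)
  then have "N \<le> card (f i \<union> (\<Union>i\<in>I. f i)) + card (period (f i \<union> (\<Union>i\<in>I. f i)))"
    by (intro weight_union) auto
  then show ?case by simp
qed simp

section \<open>Kneser's theorem\<close>

text \<open>For \<open>e \<in> A\<close>, Dyson's transform at \<open>e - b\<close> moves the elements \<open>y\<close> of \<open>B\<close> with \<open>e - b + y \<notin> A\<close>
  out of \<open>B\<close> and adjoins the elements \<open>e - b + y\<close> to \<open>A\<close>.  The total size is unchanged, the sumset
  does not grow, and \<open>a\<close> and \<open>b\<close> stay in place.  When no such transform changes the pair,
  \<open>A + B = A + b\<close>, so every difference \<open>y - b\<close> with \<open>y \<in> B\<close> is a period of \<open>A + b\<close>.\<close>

lemma heavy_subset_of_sumset: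
  fixes A B :: "'a::ab_group_add set"
  assumes "finite A" "finite B" "a \<in> A" "b \<in> B"
  shows "\<exists>S \<subseteq> A + B. a + b \<in> S \<and> card A + card B \<le> card S + card (period S)"
  using assms
proof (induction "card B" arbitrary: A B rule: less_induct)
  case less
  show ?case
  proof (cases "\<exists>e\<in>A. \<exists>y\<in>B. e - b + y \<notin> A")
    case True
    then obtain e y where e: "e \<in> A" and y: "y \<in> B" "e - b + y \<notin> A" by blast
    define A' where "A' = A \<union> (+) (e - b) ` B"
    define B' where "B' = {y \<in> B. e - b + y \<in> A}"
    have sub: "B' \<subset> B" using y by (auto simp: B'_def)
    then have "card B' < card B" using less.prems(2) by (rule psubset_card_mono[rotated])
    moreover have "finite A'" "finite B'" "a \<in> A'" "b \<in> B'"
      using less.prems e by (auto simp: A'_def B'_def)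
    ultimately obtain S where S: "S \<subseteq> A' + B'" "a + b \<in> S"
      "card A' + card B' \<le> card S + card (period S)"
      using less.hyps by blast
    have "A' + B' \<subseteq> A + B"
    proof
      fix z assume "z \<in> A' + B'"
      then obtain u v where z: "z = u + v" "u \<in> A'" "v \<in> B" "e - b + v \<in> A"
        by (auto simp: B'_def elim: set_plus_elim)
      show "z \<in> A + B"
      proof (cases "u \<in> A")
        case True
        then show ?thesis using z by auto
      next
        case False
        then obtain w where w: "w \<in> B" "u = e - b + w" using z by (auto simp: A'_def)
        have "z = (e - b + v) + w" using z(1) w(2) by (simp add: algebra_simps)
        then show ?thesis using z(4) w(1) by (metis set_plus_intro)
      qed
    qed
    moreover have "card A' + card B' = card A + card B"
    proof -
      have "A' = A \<union> (+) (e - b) ` (B - B')" by (auto simp: A'_def B'_def)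
      moreover have "A \<inter> (+) (e - b) ` (B - B') = {}" by (auto simp: B'_def)
      ultimately have "card A' = card A + card (B - B')"
        using less.prems by (simp add: card_Un_disjoint card_translate)
      moreover have "card (B - B') + card B' = card B"
        using sub less.prems(2) card_Diff_subset[of B' B] card_mono[of B B']
        by (simp add: finite_subset psubset_imp_subset)
      ultimately show ?thesis by linarith
    qed
    ultimately show ?thesis using S by auto
  next
    case False
    let ?S = "(+) b ` A"
    have "y - b \<in> period ?S" if "y \<in> B" for y
    proof -
      have "y - b \<in> period A"
      proof (rule period_finiteI[OF less.prems(1)])
        fix e assume "e \<in> A"
        then show "e + (y - b) \<in> A" using False that by (simp add: algebra_simps)
      qed
      then show ?thesis by (simp add: period_translate)
    qed
    then have "(\<lambda>y. y - b) ` B \<subseteq> period ?S" by blast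
    moreover have "finite (period ?S)" using less.prems by (intro finite_period) auto
    ultimately have "card ((\<lambda>y. y - b) ` B) \<le> card (period ?S)" by (rule card_mono[rotated])
    moreover have "card ((\<lambda>y. y - b) ` B) = card B" by (simp add: card_image inj_on_def)
    moreover have "?S \<subseteq> A + B"
      using less.prems(4) by (auto simp: add.commute[of b])
    moreover have "a + b \<in> ?S" using less.prems(3) by (simp add: add.commute rev_image_eqI)
    ultimately show ?thesis by (intro exI[of _ ?S]) (simp add: card_translate)
  qed
qed

theorem kneser:
  fixes A B :: "'a::ab_group_add set"
  assumes "finite A" "finite B" "A \<noteq> {}" "B \<noteq> {}"
  shows "card A + card B \<le> card (A + B) + card (period (A + B))"
proof -
  have fin: "finite (A + B)" and ne: "A + B \<noteq> {}"
    using assms by (auto simp: finite_set_plus set_plus_def)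
  have "\<exists>S \<subseteq> A + B. c \<in> S \<and> card A + card B \<le> card S + card (period S)" if "c \<in> A + B" for c
    using that heavy_subset_of_sumset[OF assms(1,2)] by (elim set_plus_elim) auto
  then obtain f where f: "\<And>c. c \<in> A + B \<Longrightarrow>
      f c \<subseteq> A + B \<and> c \<in> f c \<and> card A + card B \<le> card (f c) + card (period (f c))"
    by metis
  then have "(\<Union>c\<in>A + B. f c) = A + B" by blast
  moreover have "finite (f c) \<and> f c \<noteq> {} \<and> card A + card B \<le> card (f c) + card (period (f c))"
    if "c \<in> A + B" for c
    using f[OF that] fin by (auto intro: finite_subset)
  then have "card A + card B \<le> card (\<Union>c\<in>A + B. f c) + card (period (\<Union>c\<in>A + B. f c))"
    by (rule weight_UNION[OF fin ne])
  ultimately show ?thesis by simp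
qed

text \<open>\<open>D + (A + B)\<close> is a union of translates of \<open>A + B\<close>, all of the same weight.\<close>

lemma kneser_add_set:
  fixes A B D :: "'a::ab_group_add set"
  assumes "finite A" "finite B" "finite D" "A \<noteq> {}" "B \<noteq> {}" "D \<noteq> {}"
  shows "card A + card B \<le> card (D + (A + B)) + card (period (D + (A + B)))"
proof -
  have eq: "D + (A + B) = (\<Union>d\<in>D. (+) d ` (A + B))" by (auto simp: set_plus_def)
  have "finite ((+) d ` (A + B)) \<and> (+) d ` (A + B) \<noteq> {} \<and>
      card A + card B \<le> card ((+) d ` (A + B)) + card (period ((+) d ` (A + B)))" for d
    using kneser[of A B] assms
    by (auto simp: card_translate period_translate finite_set_plus set_plus_def)
  then show ?thesis unfolding eq by (intro weight_UNION[OF assms(3,6)]) blast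
qed

section \<open>Trios\<close>

lemma deficiency_first_le:
  fixes A B C :: "'a::ab_group_add set"
  assumes "trio A B C" and A: "cofinite_set A" and fin: "finite B" "finite C"
  shows "deficiency_first A B C \<le> int (card (period (A + B + C)))"
proof -
  let ?S = "A + B + C"
  define D where "D = - ?S"
  define X where "X = D + (uminus ` B + uminus ` C)"
  have ne: "B \<noteq> {}" "C \<noteq> {}" "D \<noteq> {}" using assms(1) by (auto simp: trio_def D_def)
  then have "cofinite_set ?S" using A by (meson cofinite_sumset ex_in_conv)
  then have "finite D" by (simp add: cofinite_set_def D_def Compl_eq_Diff_UNIV)
  then have "card B + card C \<le> card X + card (period X)"
    using kneser_add_set[of "uminus ` B" "uminus ` C" D] fin ne by (simp add: X_def card_image)
  moreover have X_sub: "X \<subseteq> UNIV - A"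
  proof
    fix z assume "z \<in> X"
    then obtain d b c where z: "d \<in> D" "b \<in> B" "c \<in> C" "z = d + (- b + - c)"
      unfolding X_def by (auto elim!: set_plus_elim)
    have "z + b + c = d" using z(4) by (simp add: algebra_simps)
    then show "z \<in> UNIV - A"
      using z(1-3) unfolding D_def by (metis Compl_iff DiffI UNIV_I set_plus_intro)
  qed
  then have "card X \<le> card (UNIV - A)" using A by (simp add: card_mono cofinite_set_def)
  moreover have "card (period X) \<le> card (period ?S)"
  proof (rule card_mono)
    show "finite (period ?S)" by (rule finite_period_trio[OF assms(1)])
    show "period X \<subseteq> period ?S"
    proof
      fix g assume g: "g \<in> period X"
      have "g \<in> period D"
      proof (rule period_finiteI[OF \<open>finite D\<close>], rule ccontr)
        fix d assume d: "d \<in> D" and "d + g \<notin> D"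
        then obtain a b c where abc: "a \<in> A" "b \<in> B" "c \<in> C" "d + g = a + b + c"
          by (auto simp: D_def elim!: set_plus_elim)
        (* The point d - b - c of X is moved by g to a, which does not belong to X. *)
        have "d + (- b + - c) \<in> X" using d abc unfolding X_def by (intro set_plus_intro) auto
        then have "d + (- b + - c) + g \<in> X" using period_add_iff[OF g] by simp
        moreover have "d + (- b + - c) + g = a" using abc(4) by (simp add: algebra_simps)
        ultimately show False using abc(1) X_sub by auto
      qed
      then show "g \<in> period ?S" by (simp add: D_def period_compl)
    qed
  qed
  ultimately show ?thesis unfolding deficiency_first_def by linarith
qed

theorem theorem2:
  fixes A B C :: "'a::ab_group_add set"
  assumes "trio A B C"
  shows "deficiency A B C \<le> Fin (int (card (period (A + B + C))))"
proof (cases rule: deficiency_cases[OF assms])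
  case 1
  then show ?thesis by simp
next
  case 2
  then show ?thesis using deficiency_first_le[OF assms] by simp
next
  case 3
  then show ?thesis
    using deficiency_first_le[OF trio_permute(1)[OF assms]] sumset_commute3(1)[of B A C] by simp
next
  case 4
  then show ?thesis
    using deficiency_first_le[OF trio_permute(1)[OF trio_permute(2)[OF assms]]]
      sumset_commute3(1)[of C A B] sumset_commute3(2)[of A C B] by simp
qed

end
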